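(* Let $f:\mathbb{R}\to\mathbb{R}$ be convex and $L$-smooth with $L>0$, with $\operatorname{Argmin} f\neq\varnothing$ and $f^*=\min f(\mathbb{R})$. Let $x_0\in\mathbb{R}$ and let $(x_k)_{k\in\mathbb{N}}$ be generated by Algorithm 1 (described in the context) from $x_0$ with input parameter sequence $\widetilde t_k=\frac{k+2}{2}$ for all $k\in\mathbb{N}$. Then $f(x_k)\to f^*$ as $k\to\infty$.
   Context: $\mathbb{N}=\{0,1,2,\dots\}$. $L$-smooth means $f$ is differentiable and $|f'(x)-f'(y)|\le L|x-y|$ for all $x,y\in\mathbb{R}$. Set $T(y)=y-\tfrac1L f'(y)$. Algorithm 1 (accelerated gradient descent with restarts). Input: $x_0\in\mathbb{R}$ and a real sequence $(\widetilde t_k)_{k\in\mathbb{N}}$ (here $\widetilde t_k=\frac{k+2}{2}$). Initialization: $y_0=x_0$ and $t_k:=\widetilde t_k$ for all $k\in\mathbb{N}$. For $k=0,1,2,\dots$: set $x_{k+1}:=T(y_k)$. If $f'(y_k)(x_{k+1}-x_k)\le 0$, set $y_{k+1}:=x_{k+1}+\frac{t_k-1}{t_{k+1}}(x_{k+1}-x_k)$. Otherwise (the restart condition $f'(y_k)(x_{k+1}-x_k)>0$ holds at iteration $k$) restart: set $y_{k+1}:=x_{k+1}$ and redefine $t_{k+1+m}:=\widetilde t_m$ for all $m\in\mathbb{N}$. Stopping convention: if $f'(x_k)=0$ for some $k$, then $x_k$ is a minimizer and the algorithm is stopped; in that case the sequence is regarded as constant from that index on ($x_j=x_k$ for $j\ge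 k$). *)

theory Defs
  imports "HOL-Analysis.Analysis"
begin

definition smooth_with :: "real \<Rightarrow> (real \<Rightarrow> real) \<Rightarrow> bool" where
  "smooth_with L f \<longleftrightarrow>
     (\<forall>x. f differentiable (at x)) \<and>
     (\<forall>x y. \<bar>deriv f x - deriv f y\<bar> \<le> L * \<bar>x - y\<bar>)"

definition Argmin :: "(real \<Rightarrow> real) \<Rightarrow> real set" where
  "Argmin f = {x. is_arg_min f (\<lambda>_. True) x}"

definition grad_step :: "real \<Rightarrow> (real \<Rightarrow> real) \<Rightarrow> real \<Rightarrow> real" where
  "grad_step L f y = y - (1 / L) * deriv f y"

text \<open>
  A state before iteration \<open>k\<close> is a triple consisting of \<open>x\<^sub>k\<close>, \<open>y\<^sub>k\<close> and the current version of the
  whole parameter sequence \<open>t\<close>; a restart at iteration \<open>k\<close> overwrites the entries of \<open>t\<close> from index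
  \<open>k + 1\<close> on by the input sequence \<open>tt\<close>.  Once the derivative vanishes at \<open>x\<^sub>k\<close> the algorithm has
  stopped, which is modelled by leaving the state unchanged from then on.
\<close>

type_synonym agd_state = "real \<times> real \<times> (nat \<Rightarrow> real)"

definition agd_restart_step ::
  "real \<Rightarrow> (real \<Rightarrow> real) \<Rightarrow> (nat \<Rightarrow> real) \<Rightarrow> nat \<Rightarrow> agd_state \<Rightarrow> agd_state" where
  "agd_restart_step L f tt k = (\<lambda>(x, y, t).
     if deriv f x = 0 then (x, y, t)
     else let x' = grad_step L f y in
       if deriv f y * (x' - x) \<le> 0
       then (x', x' + (t k - 1) / t (k + 1) * (x' - x), t)
       else (x', x', \<lambda>j. if j \<ge> k + 1 then tt (j - (k + 1)) else t j))"

primrec agd_restart_state ::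
  "real \<Rightarrow> (real \<Rightarrow> real) \<Rightarrow> (nat \<Rightarrow> real) \<Rightarrow> real \<Rightarrow> nat \<Rightarrow> agd_state" where
  "agd_restart_state L f tt x0 0 = (x0, x0, tt)"
| "agd_restart_state L f tt x0 (Suc k) =
     agd_restart_step L f tt k (agd_restart_state L f tt x0 k)"

definition agd_restart ::
  "real \<Rightarrow> (real \<Rightarrow> real) \<Rightarrow> (nat \<Rightarrow> real) \<Rightarrow> real \<Rightarrow> nat \<Rightarrow> real" where
  "agd_restart L f tt x0 k = fst (agd_restart_state L f tt x0 k)"

end

theory Submission
  imports Defs
begin

text \<open>
  The gradient step never jumps over a minimizer \<open>m\<close>, so between two restarts the iterates move
  monotonically towards \<open>m\<close>, and a restart happens exactly when the extrapolation carries them to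
  the other side.  Along such a phase the slopes decrease, hence each increment is at most twice
  its predecessor; as the first extrapolation coefficient is zero, two increments precede every
  overshoot, which is therefore at most \<open>2/3\<close> of the distance to \<open>m\<close> at the beginning of the
  phase.  With infinitely many restarts the iterates thus converge to \<open>m\<close>; with finitely many they
  are eventually monotone and their limit is a critical point.
\<close>

locale smooth_convex_min =
  fixes f :: "real \<Rightarrow> real" and L m :: real
  assumes convex: "convex_on UNIV f"
    and L_pos: "L > 0"
    and smooth: "smooth_with L f"
    and min: "f m \<le> f z"
begin

section \<open>Slopes and the gradient step\<close>

lemma has_deriv: "(f has_real_derivative deriv f z) (at z)"
  using smooth unfolding smooth_with_def
  by (simp add: DERIV_deriv_iff_real_differentiable)

lemma above_tangent: "f z - f y \<ge> deriv f y * (z - y)"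
  using convex_on_imp_above_tangent[OF convex, of y z "deriv f y"] has_deriv by simp

lemma deriv_mono: "y \<le> z \<Longrightarrow> deriv f y \<le> deriv f z"
proof -
  assume "y \<le> z"
  have "deriv f y * (z - y) + deriv f z * (y - z) \<le> 0"
    using above_tangent[of y z] above_tangent[of z y] by linarith
  hence "(deriv f y - deriv f z) * (z - y) \<le> 0" by (simp add: algebra_simps)
  thus ?thesis using \<open>y \<le> z\<close> by (cases "y = z") (auto simp: mult_le_0_iff)
qed

lemma deriv_min [simp]: "deriv f m = 0"
  using DERIV_local_min[OF has_deriv[of m], of 1] min by simp

lemma critical_is_min: "deriv f z = 0 \<Longrightarrow> f z = f m"
  using above_tangent[of z m] min[of z] by simp

text \<open>The slope grows by at most \<open>L * (z - y)\<close>, so subtracting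
  \<open>1 / L\<close> times it cannot reverse the order. As \<open>m\<close> is a fixed point, a
  gradient step never crosses it.\<close>

lemma grad_step_mono: "y \<le> z \<Longrightarrow> grad_step L f y \<le> grad_step L f z"
proof -
  assume "y \<le> z"
  hence "deriv f z - deriv f y \<le> L * (z - y)"
    using smooth unfolding smooth_with_def by (metis abs_le_D1 abs_of_nonneg diff_ge_0_iff_ge)
  hence "(deriv f z - deriv f y) / L \<le> z - y"
    using L_pos by (simp add: divide_le_eq mult.commute)
  thus ?thesis by (simp add: grad_step_def diff_divide_distrib)
qed

lemma grad_step_min [simp]: "grad_step L f m = m"
  by (simp add: grad_step_def)

lemma isCont_deriv: "isCont (deriv f) z"
proof -
  have "L-lipschitz_on UNIV (deriv f)"
    using smooth L_pos unfolding smooth_with_def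
    by (intro lipschitz_onI) (auto simp: dist_real_def)
  from lipschitz_on_continuous_on[OF this] show ?thesis
    by (simp add: continuous_on_eq_continuous_at)
qed

section \<open>The invariant of a phase\<close>

text \<open>
  The number \<open>s = \<plusminus>1\<close> is the direction of motion, \<open>D\<close> bounds the distance from \<open>m\<close> at the last
  restart, and \<open>n\<close> counts the iterations since then.  The last inequality is the previous one for the
  next state, because the next increment is at most \<open>s * (y - x) - s * (deriv f x / L)\<close>.
\<close>

definition phase :: "nat \<Rightarrow> agd_state \<Rightarrow> real \<Rightarrow> real \<Rightarrow> bool" where
  "phase k = (\<lambda>(x, y, t) s D. (s = 1 \<or> s = -1) \<and> s * (m - x) > 0 \<and> s * (y - x) \<ge> 0 \<and>
     s * (m - x) + 3/2 * (s * (y - x)) \<le> D \<and>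
     (\<exists>n. (\<forall>j. t (k + j) = (real (n + j) + 2) / 2) \<and>
       (n \<noteq> 0 \<longrightarrow> s * (m - x) + 1/2 * (s * (y - x) - s * (deriv f x / L)) \<le> D)))"

text \<open>The sign of the slope at \<open>y\<close> decides. Before \<open>m\<close> the phase
  goes on, with an increment at least as long as a plain gradient step from \<open>x\<close>; beyond
  \<open>m\<close> a restart reverses the direction and shrinks the bound. Excluding critical
  iterates keeps \<open>x'\<close> off \<open>m\<close>.\<close>

lemma phase_step:
  assumes ph: "phase k (x, y, t) s D"
    and tt: "\<And>i. tt i = (real i + 2) / 2"
    and step: "agd_restart_step L f tt k (x, y, t) = (x', y', t')"
    and nz: "deriv f x \<noteq> 0" "deriv f x' \<noteq> 0"
  shows "(phase (Suc k) (x', y', t') s D \<and> s * (x' - x) \<ge> \<bar>deriv f x\<bar> / L) \<or>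
    phase (Suc k) (x', y', t') (-s) (2/3 * D)"
proof -
  have s: "s = 1 \<or> s = -1" and mx: "s * (m - x) > 0" and e: "s * (y - x) \<ge> 0"
    and A: "s * (m - x) + 3/2 * (s * (y - x)) \<le> D"
    using ph by (auto simp: phase_def)
  obtain n where t: "\<And>j. t (k + j) = (real (n + j) + 2) / 2"
    and B: "n \<noteq> 0 \<Longrightarrow> s * (m - x) + 1/2 * (s * (y - x) - s * (deriv f x / L)) \<le> D"
    using ph by (auto simp: phase_def)
  define G where "G = - s * (deriv f y / L)"
  have x': "x' = grad_step L f y"
    using step nz(1) by (auto simp: agd_restart_step_def Let_def split: if_splits)
  have x'y: "s * (x' - y) = G"
    by (simp add: x' grad_step_def G_def algebra_simps)
  \<comment> \<open>Multiplying by \<open>s\<close> treats both directions of motion at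
    once.\<close>
  have mono: "s * deriv f u \<le> s * deriv f v" "s * grad_step L f u \<le> s * grad_step L f v"
    if "s * u \<le> s * v" for u v
    using s that deriv_mono grad_step_mono by auto
  have sx: "s * deriv f x \<le> 0" using mono(1)[of x m] mx by (simp add: algebra_simps)
  have sx_abs: "\<bar>deriv f x\<bar> = - s * deriv f x" using s sx by auto
  show ?thesis
  proof (cases "s * deriv f y \<le> 0")
    case True
    have G0: "G \<ge> 0" using True L_pos by (auto simp: G_def divide_le_0_iff)
    have d: "s * (x' - x) = s * (y - x) + G" using x'y by (simp add: algebra_simps)
    have "deriv f y * (x' - x) = (s * deriv f y) * (s * (x' - x))" using s by auto
    moreover have "(s * deriv f y) * (s * (x' - x)) \<le> 0"
      using True d G0 e by (intro mult_nonpos_nonneg[of "s * deriv f y"]) linarith+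
    ultimately have nr: "deriv f y * (x' - x) \<le> 0" by linarith
    \<comment> \<open>This is \<open>((n + 2) / 2 - 1) / ((n + 3) / 2)\<close>. Only
      \<open>0 \<le> b \<le> 1\<close> and its vanishing at \<open>n = 0\<close> matter.\<close>
    define b where "b = real n / (real n + 3)"
    have b: "0 \<le> b" "b \<le> 1" by (auto simp: b_def)
    have "(t k - 1) / t (k + 1) = b"
    proof -
      have "t k = (real n + 2) / 2" "t (k + 1) = (real n + 3) / 2"
        using t[of 0] t[of 1] by simp_all
      thus ?thesis by (simp only: b_def) (simp add: field_simps)
    qed
    hence y': "y' = x' + b * (x' - x)" and t': "t' = t"
      using step nz(1) nr x' by (auto simp: agd_restart_step_def Let_def)
    define d where "d = s * (x' - x)"
    have dd: "d = s * (y - x) + G" using d by (simp add: d_def)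
    have d0: "d \<ge> 0" using dd e G0 by linarith
    have e': "s * (y' - x') = b * d" by (simp add: y' d_def)
    have bd: "0 \<le> b * d" "b * d \<le> d"
      using b d0 by (auto simp: mult_left_le_one_le)
    have "s * deriv f y < 0"
    proof -
      \<comment> \<open>Otherwise \<open>x' = y\<close> would be critical.\<close>
      have "deriv f y \<noteq> 0" using nz(2) x' by (auto simp: grad_step_def)
      thus ?thesis using True s by auto
    qed
    hence "s * y < s * m" using mono(1)[of m y] by fastforce
    hence "s * x' \<le> s * m" using mono(2)[of y m] x' by simp
    moreover have "x' \<noteq> m" using nz(2) by auto
    ultimately have mx': "s * (m - x') > 0" using s by auto
    have gx': "- (s * (deriv f x' / L)) \<le> G"
    proof -
      have "s * y \<le> s * x'" using x'y G0 by (simp add: algebra_simps)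
      from mono(1)[OF this] show ?thesis using L_pos by (simp add: G_def divide_right_mono)
    qed
    have Gg: "G \<le> - (s * (deriv f x / L))"
    proof -
      have "s * x \<le> s * y" using e by (simp add: algebra_simps)
      from mono(1)[OF this] show ?thesis using L_pos by (simp add: G_def divide_right_mono)
    qed
    have sm: "s * (m - x') = s * (m - x) - d" by (simp add: d_def algebra_simps)
    \<comment> \<open>Without extrapolation (\<open>n = 0\<close>) the distance just shrinks.
      Otherwise \<open>b * d \<le> d\<close> leaves at most \<open>s * (m - x) + d / 2\<close>, and
      \<open>d\<close> is at most the increment bound in \<open>B\<close>.\<close>
    have A': "s * (m - x') + 3/2 * (s * (y' - x')) \<le> D"
    proof (cases "n = 0")
      case True
      hence "b * d = 0" by (simp add: b_def)
      thus ?thesis using sm e' A e d0 by linarith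
    next
      case False
      show ?thesis using B[OF False] sm e' bd dd Gg by argo
    qed
    \<comment> \<open>Both \<open>b * d\<close> and the gradient step at \<open>x'\<close> are at
      most \<open>d\<close>, so half their sum is compensated by the advance \<open>d\<close>
      towards \<open>m\<close>.\<close>
    have B': "s * (m - x') + 1/2 * (s * (y' - x') - s * (deriv f x' / L)) \<le> D"
      using sm e' bd gx' dd e A by argo
    have "phase (Suc k) (x', y', t') s D"
      unfolding phase_def prod.case
    proof (intro conjI exI[of _ "Suc n"] allI impI)
      show "t' (Suc k + j) = (real (Suc n + j) + 2) / 2" for j
        using t[of "Suc j"] by (simp add: t')
    qed (use s mx' e' bd A' B' in auto)
    moreover have "s * (x' - x) \<ge> \<bar>deriv f x\<bar> / L"
    proof -
      have "s * grad_step L f x \<le> s * x'"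
        using mono(2)[of x y] e x' by (simp add: algebra_simps)
      thus ?thesis by (simp add: sx_abs grad_step_def algebra_simps)
    qed
    ultimately show ?thesis by blast
  next
    case False
    hence "s * m < s * y" using mono(1)[of y m] by fastforce
    hence "s * m \<le> s * x'" using mono(2)[of m y] x' by simp
    moreover have "x' \<noteq> m" using nz(2) by auto
    ultimately have mx': "s * (x' - m) > 0" using s by auto
    have G0: "G \<le> 0" using False L_pos by (simp add: G_def)
    have "deriv f y * (x' - x) = (s * deriv f y) * (s * (x' - x))" using s by auto
    moreover have "s * (x' - x) > 0" using mx mx' by (simp add: algebra_simps)
    ultimately have "deriv f y * (x' - x) > 0"
      using False by (metis mult_pos_pos not_le)
    hence y': "y' = x'" and t': "t' = (\<lambda>j. if j \<ge> k + 1 then tt (j - (k + 1)) else t j)"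
      using step nz(1) x' by (auto simp: agd_restart_step_def Let_def)
    \<comment> \<open>The gradient step at \<open>y\<close> points back towards \<open>m\<close>, so
      extrapolation alone bounds the overshoot; \<open>A\<close> bounds \<open>s * (y - x)\<close>
      by \<open>2/3 * D\<close>.\<close>
    have "s * (x' - m) \<le> s * (y - x) - s * (m - x)"
      using x'y G0 by (simp add: algebra_simps)
    hence "s * (x' - m) \<le> 2/3 * D" using A mx by linarith
    hence "phase (Suc k) (x', y', t') (-s) (2/3 * D)"
      unfolding phase_def prod.case
      by (intro conjI exI[of _ 0]) (use s mx' in \<open>auto simp: y' t' tt algebra_simps\<close>)
    thus ?thesis by blast
  qed
qed

lemma phase_dist:
  assumes "phase k st s D"
  shows "\<bar>fst st - m\<bar> \<le> D"
proof -
  obtain x y t where st: "st = (x, y, t)" by (cases st)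
  have s: "s = 1 \<or> s = -1" and mx: "s * (m - x) > 0" and "s * (y - x) \<ge> 0"
    "s * (m - x) + 3/2 * (s * (y - x)) \<le> D"
    using assms unfolding phase_def st prod.case by blast+
  hence "s * (m - x) \<le> D" by linarith
  thus ?thesis using s mx unfolding st by auto
qed

lemma phase_sign:
  assumes "phase k st s D"
  shows "s = 1 \<or> s = -1"
  using assms by (cases st) (auto simp: phase_def)

section \<open>Convergence of the function values\<close>

lemma stopped_const:
  assumes "deriv f (agd_restart L f tt x0 k) = 0"
  shows "agd_restart L f tt x0 (k + j) = agd_restart L f tt x0 k"
proof -
  have "agd_restart_state L f tt x0 (k + j) = agd_restart_state L f tt x0 k"
  proof (induction j)
    case (Suc j)
    thus ?case using assms
      by (cases "agd_restart_state L f tt x0 k")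
        (simp add: agd_restart_def agd_restart_step_def)
  qed simp
  thus ?thesis by (simp add: agd_restart_def)
qed

text \<open>Covers the iterates after the last restart: they are monotone and bounded, so their
  increments tend to zero and force the slope to vanish at the limit.\<close>

lemma one_sided_tendsto_min:
  assumes "s = 1 \<or> s = -1"
    and step: "\<And>k. s * (x (Suc k) - x k) \<ge> \<bar>deriv f (x k)\<bar> / L"
    and bdd: "\<And>k. \<bar>x k - m\<bar> \<le> D"
  shows "(\<lambda>k. f (x k)) \<longlonglongrightarrow> f m"
proof -
  have "incseq (\<lambda>k. s * x k)"
  proof (rule incseq_SucI)
    fix k
    have "0 \<le> \<bar>deriv f (x k)\<bar> / L" using L_pos by simp
    with step[of k] show "s * x k \<le> s * x (Suc k)" by (simp add: algebra_simps)
  qed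
  moreover have "s * x k \<le> \<bar>m\<bar> + D" for k
    using bdd[of k] assms(1) by auto
  ultimately obtain l where "(\<lambda>k. s * x k) \<longlonglongrightarrow> l"
    using incseq_convergent[of "\<lambda>k. s * x k"] by blast
  hence "(\<lambda>k. s * (s * x k)) \<longlonglongrightarrow> s * l" by (intro tendsto_intros)
  moreover have "s * (s * z) = z" for z using assms(1) by auto
  ultimately have lim: "x \<longlonglongrightarrow> s * l" by simp
  have "(\<lambda>k. s * (x (Suc k) - x k)) \<longlonglongrightarrow> s * (s * l - s * l)"
    by (intro tendsto_intros lim LIMSEQ_Suc)
  moreover have "(\<lambda>k. \<bar>deriv f (x k)\<bar> / L) \<longlonglongrightarrow> \<bar>deriv f (s * l)\<bar> / L"
    by (intro tendsto_intros isCont_tendsto_compose[OF isCont_deriv] lim)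
      (use L_pos in simp)
  ultimately have "\<bar>deriv f (s * l)\<bar> / L \<le> 0"
    using LIMSEQ_le[of _ "\<bar>deriv f (s * l)\<bar> / L" _ 0] step by fastforce
  hence "deriv f (s * l) = 0" using L_pos by (simp add: divide_le_0_iff)
  moreover have "(\<lambda>k. f (x k)) \<longlonglongrightarrow> f (s * l)"
    by (rule isCont_tendsto_compose[OF DERIV_isCont[OF has_deriv] lim])
  ultimately show ?thesis using critical_is_min by metis
qed

lemma agd_restart_tendsto_min:
  assumes tt: "\<And>k. tt k = (real k + 2) / 2"
  shows "(\<lambda>k. f (agd_restart L f tt x0 k)) \<longlonglongrightarrow> f m"
proof (cases "\<exists>k. deriv f (agd_restart L f tt x0 k) = 0")
  case True
  then obtain k where k: "deriv f (agd_restart L f tt x0 k) = 0" by blast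
  have "(\<lambda>j. f (agd_restart L f tt x0 (j + k))) \<longlonglongrightarrow> f m"
    using stopped_const[OF k] critical_is_min[OF k] by (simp add: add.commute)
  thus ?thesis by (rule LIMSEQ_offset)
next
  case False
  define st where "st = agd_restart_state L f tt x0"
  define x where "x = (\<lambda>k. fst (st k))"
  have x_eq: "agd_restart L f tt x0 = x" by (rule ext) (simp add: x_def st_def agd_restart_def)
  have nz: "deriv f (x k) \<noteq> 0" for k using False x_eq by simp
  \<comment> \<open>Direction and bound are not part of the state, so they are chosen along the run
    as a pair \<open>p\<close>. The reversal of the sign need not be recorded, since only the
    shrinking bound is used after infinitely many restarts.\<close>
  define R where "R = (\<lambda>k (p :: real \<times> real) q.
    (q = p \<and> fst p * (x (Suc k) - x k) \<ge> \<bar>deriv f (x k)\<bar> / L) \<or> snd q = 2/3 * snd p)"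
  have "\<exists>p. \<forall>k. phase k (st k) (fst (p k)) (snd (p k)) \<and> R k (p k) (p (Suc k))"
  proof (rule dependent_nat_choice)
    have "x0 \<noteq> m" using nz[of 0] by (auto simp: x_def st_def)
    hence "phase 0 (st 0) (sgn (m - x0)) \<bar>m - x0\<bar>"
      unfolding phase_def st_def agd_restart_state.simps prod.case
      by (intro conjI exI[of _ 0]) (auto simp: tt sgn_real_def)
    thus "\<exists>p. phase 0 (st 0) (fst p) (snd p)" by (metis fst_conv snd_conv)
  next
    fix p :: "real \<times> real" and k
    assume ph: "phase k (st k) (fst p) (snd p)"
    obtain a b t where st: "st k = (a, b, t)" by (cases "st k")
    obtain a' b' t' where st': "st (Suc k) = (a', b', t')" by (cases "st (Suc k)")
    have "agd_restart_step L f tt k (a, b, t) = (a', b', t')"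
      using st st' by (simp add: st_def)
    from phase_step[OF _ tt this] ph nz[of k] nz[of "Suc k"]
    have "(phase (Suc k) (st (Suc k)) (fst p) (snd p) \<and>
        fst p * (x (Suc k) - x k) \<ge> \<bar>deriv f (x k)\<bar> / L) \<or>
      phase (Suc k) (st (Suc k)) (- fst p) (2/3 * snd p)"
      by (simp add: st st' x_def)
    thus "\<exists>q. phase (Suc k) (st (Suc k)) (fst q) (snd q) \<and> R k p q"
      unfolding R_def by (metis fst_conv snd_conv)
  qed
  then obtain p where ph: "\<And>k. phase k (st k) (fst (p k)) (snd (p k))"
    and R: "\<And>k. R k (p k) (p (Suc k))" by blast
  define D where "D = (\<lambda>k. snd (p k))"
  have dist: "\<bar>x k - m\<bar> \<le> D k" for k
    using phase_dist[OF ph[of k]] by (simp add: D_def x_def)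
  hence D0: "0 \<le> D k" for k using abs_ge_zero order_trans by blast
  have D_Suc: "D (Suc k) \<le> D k" for k
    using R[of k] D0[of k] by (auto simp: R_def D_def)
  show ?thesis
  proof (cases "\<forall>N. \<exists>k\<ge>N. D (Suc k) = 2/3 * D k")
    case True
    obtain d where d: "D \<longlonglongrightarrow> d" and le: "\<And>k. d \<le> D k"
      using decseq_convergent[OF decseq_SucI[of D, OF D_Suc], of 0] D0 by blast
    have "d \<le> 0"
    proof (rule ccontr)
      assume "\<not> d \<le> 0"
      hence "d < 3/2 * d" by simp
      \<comment> \<open>Once \<open>D k\<close> is below \<open>3/2 * d\<close>, one more factor
        \<open>2/3\<close> would push the decreasing sequence below its limit
        \<open>d\<close>.\<close>
      then obtain N where N: "\<And>k. k \<ge> N \<Longrightarrow> D k < 3/2 * d"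
        using order_tendstoD(2)[OF d, of "3/2 * d"] unfolding eventually_sequentially by blast
      obtain k where k: "k \<ge> N" "D (Suc k) = 2/3 * D k" using True by blast
      show False using N[OF k(1)] k(2) le[of "Suc k"] by linarith
    qed
    hence "D \<longlonglongrightarrow> 0" using d LIMSEQ_le_const[OF d, of 0] D0 by force
    hence "(\<lambda>k. x k - m) \<longlonglongrightarrow> 0"
      by (rule Lim_null_comparison[rotated]) (simp add: dist)
    hence "x \<longlonglongrightarrow> m" by (rule LIM_zero_cancel)
    thus ?thesis unfolding x_eq by (rule isCont_tendsto_compose[OF DERIV_isCont[OF has_deriv]])
  next
    case False
    then obtain N where N: "\<And>k. k \<ge> N \<Longrightarrow> D (Suc k) \<noteq> 2/3 * D k" by blast
    \<comment> \<open>With the shrinking alternative of \<open>R\<close> ruled out, direction and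
      bound are frozen from \<open>N\<close> on.\<close>
    have p: "p (Suc k) = p k" "fst (p k) * (x (Suc k) - x k) \<ge> \<bar>deriv f (x k)\<bar> / L"
      if "k \<ge> N" for k
      using R[of k] N[OF that] by (auto simp: R_def D_def)
    have pN: "p (k + N) = p N" for k
      by (induction k) (simp_all add: p)
    have "(\<lambda>k. f (x (k + N))) \<longlonglongrightarrow> f m"
    proof (rule one_sided_tendsto_min)
      show "fst (p N) = 1 \<or> fst (p N) = -1" by (rule phase_sign[OF ph])
      show "\<bar>deriv f (x (k + N))\<bar> / L \<le> fst (p N) * (x (Suc k + N) - x (k + N))" for k
        using p(2)[of "k + N"] pN[of k] by simp
      show "\<bar>x (k + N) - m\<bar> \<le> D N" for k
        using dist[of "k + N"] pN[of k] by (simp add: D_def)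
    qed
    thus ?thesis unfolding x_eq by (rule LIMSEQ_offset)
  qed
qed

end

theorem corollary11:
  fixes f :: "real \<Rightarrow> real" and L x0 fstar :: real and x tt :: "nat \<Rightarrow> real"
  assumes "convex_on UNIV f"
    and "L > 0"
    and "smooth_with L f"
    and "Argmin f \<noteq> {}"
    and "fstar = (LEAST v. v \<in> range f)"
    and "\<And>k. tt k = (real k + 2) / 2"
    and "\<And>k. x k = agd_restart L f tt x0 k"
  shows "(\<lambda>k. f (x k)) \<longlonglongrightarrow> fstar"
proof -
  obtain m where m: "\<And>z. f m \<le> f z"
    using assms(4) by (auto simp: Argmin_def is_arg_min_linorder)
  interpret smooth_convex_min f L m
    by unfold_locales (use assms m in auto)
  have "fstar = f m"
    unfolding assms(5) by (rule Least_equality) (auto simp: m)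
  thus ?thesis using agd_restart_tendsto_min[OF assms(6)] by (simp add: assms(7))
qed

end
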